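(* Let $(N,A,c)$ be a public bads instance and let $x\in\Delta(A)$ be proportionally fair with $c_i(x)>0$ for all $i\in N$. Then $x$ is in the bounded-externality core.
   Context: A public bads instance $(N,A,c)$ consists of agents $N=\{1,\dots,n\}$, a finite set $A$ of alternatives (bads), and cost functions $c_i:A\to\mathbb{R}_{\ge 0}$, $i\in N$. $\Delta(A)$ is the set of lotteries (probability vectors) on $A$; $c_i(x)=\sum_{a\in A}x(a)c_i(a)$ and $c(x)=(c_i(x))_{i\in N}$. Standing assumptions: $0\notin\{c(x):x\in\Delta(A)\}$, and for every $i\in N$ there is $a\in A$ with $c_i(a)<\max_{a'\in A}c_i(a')$. Proportional fairness: $x\in\Delta(A)$ is proportionally fair if $\frac1n\sum_{i\in N}\frac{c_i(y)}{c_i(x)}\ge 1$ for all $y\in\Delta(A)$, with conventions $0/0=1$ and $\alpha/0=+\infty$ for $\alpha>0$. Bounded-externality (BE) core: $x\in\Delta(A)$ is in the BE core if there exist no $\emptyset\ne S\subseteq N$, $y\in\Delta(A)$ and $\alpha\in\mathbb{R}_{\ge0}$ such that (1) $c_i(y)\le\alpha\, c_i(x)$ for all $i\in N\setminus S$; and (2) $c_i(y)\le\frac{|N|-|N\setminus S|\alpha}{|S|}c_i(x)$ for all $i\in S$, with at least one of these inequalities (for $i \in S$) strict. *)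

theory Defs
  imports "HOL-Library.FuncSet" "HOL-Library.Extended_Real"
begin

text \<open>Agents are the numbers \<open>1, \<dots>, n\<close>; the cost functions \<open>c i\<close> and the alternatives matter only
  for \<open>i \<in> {1..n}\<close> and \<open>a \<in> A\<close>. A lottery is represented by the function that is zero off \<open>A\<close>.\<close>

definition lotteries :: "'a set \<Rightarrow> ('a \<Rightarrow> real) set" where
  "lotteries A = {x. (\<forall>a\<in>A. 0 \<le> x a) \<and> (\<forall>a. a \<notin> A \<longrightarrow> x a = 0) \<and> (\<Sum>a\<in>A. x a) = 1}"

definition expected_cost :: "'a set \<Rightarrow> (nat \<Rightarrow> 'a \<Rightarrow> real) \<Rightarrow> nat \<Rightarrow> ('a \<Rightarrow> real) \<Rightarrow> real" where
  "expected_cost A c i x = (\<Sum>a\<in>A. x a * c i a)"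

definition cost_vector :: "nat \<Rightarrow> 'a set \<Rightarrow> (nat \<Rightarrow> 'a \<Rightarrow> real) \<Rightarrow> ('a \<Rightarrow> real) \<Rightarrow> nat \<Rightarrow> real" where
  "cost_vector n A c x = (\<lambda>i\<in>{1..n}. expected_cost A c i x)"

text \<open>The two last clauses are the standing assumptions: no lottery has the zero cost vector, and
  no agent is indifferent between all alternatives. If \<open>A\<close> is nonempty, the former
  forces \<open>n \<ge> 1\<close>.\<close>

definition public_bads_instance :: "nat \<Rightarrow> 'a set \<Rightarrow> (nat \<Rightarrow> 'a \<Rightarrow> real) \<Rightarrow> bool" where
  "public_bads_instance n A c \<longleftrightarrow>
     finite A \<and>
     (\<forall>i\<in>{1..n}. \<forall>a\<in>A. 0 \<le> c i a) \<and>
     (\<lambda>i\<in>{1..n}. 0) \<notin> cost_vector n A c ` lotteries A \<and>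
     (\<forall>i\<in>{1..n}. \<exists>a\<in>A. c i a < Max (c i ` A))"

text \<open>Quotient of nonnegative reals with the conventions \<open>0/0 = 1\<close> and \<open>u/0 = \<infinity>\<close> for \<open>u > 0\<close>
  (library division by zero would give \<open>0\<close> on the reals).\<close>

definition cost_ratio :: "real \<Rightarrow> real \<Rightarrow> ereal" where
  "cost_ratio u v = (if v = 0 then (if u = 0 then 1 else \<infinity>) else ereal (u / v))"

definition proportionally_fair ::
    "nat \<Rightarrow> 'a set \<Rightarrow> (nat \<Rightarrow> 'a \<Rightarrow> real) \<Rightarrow> ('a \<Rightarrow> real) \<Rightarrow> bool" where
  "proportionally_fair n A c x \<longleftrightarrow>
     x \<in> lotteries A \<and>
     (\<forall>y\<in>lotteries A.
        ereal (1 / real n) * (\<Sum>i\<in>{1..n}. cost_ratio (expected_cost A c i y) (expected_cost A c i x)) \<ge> 1)"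

definition be_core :: "nat \<Rightarrow> 'a set \<Rightarrow> (nat \<Rightarrow> 'a \<Rightarrow> real) \<Rightarrow> ('a \<Rightarrow> real) set" where
  "be_core n A c =
     {x \<in> lotteries A.
        \<not> (\<exists>S y \<alpha>. S \<noteq> {} \<and> S \<subseteq> {1..n} \<and> y \<in> lotteries A \<and> 0 \<le> \<alpha> \<and>
             (\<forall>i\<in>{1..n} - S. expected_cost A c i y \<le> \<alpha> * expected_cost A c i x) \<and>
             (\<forall>i\<in>S. expected_cost A c i y
                \<le> (real (card {1..n}) - real (card ({1..n} - S)) * \<alpha>) / real (card S)
                    * expected_cost A c i x) \<and>
             (\<exists>i\<in>S. expected_cost A c i y
                < (real (card {1..n}) - real (card ({1..n} - S)) * \<alpha>) / real (card S)
                    * expected_cost A c i x))}"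

end

theory Submission
  imports Defs
begin

text \<open>A deviation \<open>(S, y, \<alpha>)\<close> bounds the ratio \<open>c\<^sub>i(y) / c\<^sub>i(x)\<close> by \<open>\<alpha>\<close> off \<open>S\<close> and by
  \<open>(n - |N \<setminus> S| \<alpha>) / |S|\<close> on \<open>S\<close>. These bounds add up to exactly \<open>n\<close>, so with one of them strict
  the average ratio is below \<open>1\<close>, against proportional fairness.\<close>

text \<open>Positive costs at \<open>x\<close> keep \<open>cost_ratio\<close> away from its
  conventions for zero denominators, so the extended-real sum is an ordinary real one.\<close>

lemma proportionally_fair_sum_ge:
  assumes "proportionally_fair n A c x" and "y \<in> lotteries A"
    and pos: "\<And>i. i \<in> {1..n} \<Longrightarrow> 0 < expected_cost A c i x"
  shows "real n \<le> (\<Sum>i\<in>{1..n}. expected_cost A c i y / expected_cost A c i x)"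
    (is "_ \<le> ?s")
proof -
  have "(\<Sum>i\<in>{1..n}. cost_ratio (expected_cost A c i y) (expected_cost A c i x)) = ereal ?s"
    unfolding sum_ereal[symmetric]
    by (intro sum.cong) (use pos in \<open>force simp: cost_ratio_def\<close>)+
  then have "1 \<le> ?s / real n"
    using assms(1,2) by (auto simp: proportionally_fair_def one_ereal_def)
  then show ?thesis
    \<comment> \<open>Clearing the denominator needs \<open>n\<close> nonzero; for
      \<open>n = 0\<close> the sum is empty and the claim reads 0 \<le> 0.\<close>
    by (cases "n = 0") (simp_all add: field_simps)
qed

theorem theorem4p10:
  fixes n :: nat and A :: "'a set" and c :: "nat \<Rightarrow> 'a \<Rightarrow> real" and x :: "'a \<Rightarrow> real"
  assumes "public_bads_instance n A c"
    and "x \<in> lotteries A"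
    and "proportionally_fair n A c x"
    and "\<forall>i\<in>{1..n}. expected_cost A c i x > 0"
  shows "x \<in> be_core n A c"
proof (rule ccontr)
  assume "x \<notin> be_core n A c"
  then obtain S y \<alpha> where S: "S \<noteq> {}" "S \<subseteq> {1..n}" and y: "y \<in> lotteries A"
    and out: "\<forall>i\<in>{1..n} - S. expected_cost A c i y \<le> \<alpha> * expected_cost A c i x"
    and ins: "\<forall>i\<in>S. expected_cost A c i y
        \<le> (real (card {1..n}) - real (card ({1..n} - S)) * \<alpha>) / real (card S) * expected_cost A c i x"
    and strict: "\<exists>i\<in>S. expected_cost A c i y
        < (real (card {1..n}) - real (card ({1..n} - S)) * \<alpha>) / real (card S) * expected_cost A c i x"
    using assms(2) unfolding be_core_def by blast
  define \<beta> where "\<beta> = (real (card {1..n}) - real (card ({1..n} - S)) * \<alpha>) / real (card S)"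
  define r where "r i = expected_cost A c i y / expected_cost A c i x" for i
  have pos: "0 < expected_cost A c i x" if "i \<in> {1..n}" for i
    using assms(4) that by blast
  have fin: "finite S"
    using S(2) finite_subset by blast
  \<comment> \<open>Dividing by the positive cost at \<open>x\<close> turns the deviation's
    inequalities into bounds on \<open>r\<close>; a single strict one makes the finite sum
    strict.\<close>
  have "sum r S < (\<Sum>i\<in>S. \<beta>)"
  proof (rule sum_strict_mono_ex1[OF fin])
    show "\<forall>i\<in>S. r i \<le> \<beta>"
      using ins pos S(2) unfolding r_def \<beta>_def[symmetric]
      by (metis pos_divide_le_eq subsetD)
    show "\<exists>i\<in>S. r i < \<beta>"
      using strict pos S(2) unfolding r_def \<beta>_def[symmetric]
      by (metis pos_divide_less_eq subsetD)
  qed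
  moreover have "sum r ({1..n} - S) \<le> (\<Sum>i\<in>{1..n} - S. \<alpha>)"
    using out pos unfolding r_def
    by (intro sum_mono) (metis DiffD1 pos_divide_le_eq)
  moreover have "sum r {1..n} = sum r ({1..n} - S) + sum r S"
    by (rule sum.subset_diff[OF S(2)]) simp
  \<comment> \<open>As \<open>S\<close> is finite and nonempty, \<open>card S\<close> is nonzero and
    cancels the denominator of \<beta>.\<close>
  moreover have "(\<Sum>i\<in>{1..n} - S. \<alpha>) + (\<Sum>i\<in>S. \<beta>) = real n"
    using S(1) fin by (simp add: \<beta>_def)
  ultimately have "sum r {1..n} < real n"
    by linarith
  then show False
    using proportionally_fair_sum_ge[OF assms(3) y pos] unfolding r_def by simp
qed

end
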